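(* Suppose that $S:\mathbb{R}^n\to\mathbb{R}^n$ is nonexpansive, that $\mathrm{fix}\,S\neq\emptyset$, and that $\bar\alpha\in(0,1)$. Then every sequence generated by the line search iteration (with nominal step length $\bar\alpha$) satisfies $r^k\to 0$ and $x^{k+1}-x^k\to 0$ as $k\to\infty$.
   Context: $\|\cdot\|_2$ is the Euclidean norm on $\mathbb{R}^n$. $S$ is nonexpansive if $\|Su-Sv\|_2\le\|u-v\|_2$ for all $u,v\in\mathbb{R}^n$. $\mathrm{fix}\,S=\{x\in\mathbb{R}^n : x=Sx\}$ is the set of fixed points of $S$. Line search iteration: fix algorithm parameters $\bar\alpha\in(0,1)$ (nominal step length), $\epsilon\in(0,1)$ and $\alpha^{\max}\ge\bar\alpha$, and an arbitrary starting point $x^0\in\mathbb{R}^n$. For $k=0,1,2,\dots$ set $$r^k:=Sx^k-x^k,\qquad \bar x^k:=x^k+\bar\alpha r^k,\qquad \bar r^k:=S\bar x^k-\bar x^k,\qquad x^{k+1}:=x^k+\alpha_k r^k,$$ where for each $k$ the step length $\alpha_k$ satisfies: either $\alpha_k=\bar\alpha$, or $\alpha_k\in(\bar\alpha,\alpha^{\max}]$ is such that the line search test $\|r^{k+1}\|_2=\|Sx^{k+1}-x^{k+1}\|_2\le(1-\epsilon)\|\bar r^k\|_2$ holds. The choice of $\alpha_k$ is otherwise arbitrary. *)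

theory Defs
  imports "HOL-Analysis.Analysis"
begin

definition nonexpansive :: "(real ^ 'n \<Rightarrow> real ^ 'n) \<Rightarrow> bool" where
  "nonexpansive S \<longleftrightarrow> (\<forall>u v. norm (S u - S v) \<le> norm (u - v))"

definition fixed_points :: "(real ^ 'n \<Rightarrow> real ^ 'n) \<Rightarrow> (real ^ 'n) set" where
  "fixed_points S = {x. x = S x}"

definition residual :: "(real ^ 'n \<Rightarrow> real ^ 'n) \<Rightarrow> real ^ 'n \<Rightarrow> real ^ 'n" where
  "residual S x = S x - x"

(* x is the sequence of iterates, with x 0 arbitrary, and \<alpha> the sequence of step lengths.
   This is a relation rather than a recursive function because a step longer than abar that
   passes the test may be taken or declined. The last line of the definition refers to the
   nominal next iterate x k + abar *\<^sub>R residual S (x k). *)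

definition line_search_iteration ::
  "(real ^ 'n \<Rightarrow> real ^ 'n) \<Rightarrow> real \<Rightarrow> real \<Rightarrow> real \<Rightarrow> (nat \<Rightarrow> real ^ 'n) \<Rightarrow> (nat \<Rightarrow> real) \<Rightarrow> bool" where
  "line_search_iteration S abar \<epsilon> amax x \<alpha> \<longleftrightarrow>
     (\<forall>k. x (Suc k) = x k + \<alpha> k *\<^sub>R residual S (x k) \<and>
          (\<alpha> k = abar \<or>
           (\<alpha> k \<in> {abar<..amax} \<and>
            norm (residual S (x (Suc k)))
              \<le> (1 - \<epsilon>) * norm (residual S (x k + abar *\<^sub>R residual S (x k))))))"

end

theory Submission
  imports Defs
begin

text \<open>
  The residual norms \<open>norm (residual S (x k))\<close> never increase: a nominal step does not increase
  them (\<open>norm_residual_relaxed_step_le\<close>), and a longer step is taken only if it beats the nominal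
  one by the factor \<open>1 - \<epsilon>\<close>. Hence they converge to some \<open>L \<ge> 0\<close>.

  Suppose that \<open>L > 0\<close>. Each longer step multiplies the residual norm by at most \<open>1 - \<epsilon>\<close>; once the
  norm is below \<open>L / (1 - \<epsilon>)\<close>, such a step would push it below its limit. So from some index on all
  steps are nominal, and the iteration has become the Krasnoselskii-Mann iteration. For the latter
  the squared distance to a fixed point drops in each step by at least
  \<open>abar * (1 - abar) * norm (residual S (x k)) ^ 2\<close> (\<open>relaxed_step_fixed_point_descent\<close>), hence by
  at least the constant \<open>abar * (1 - abar) * L\<^sup>2 > 0\<close>, which cannot go on forever.

  The residual norm has to be treated first because it is monotone along all steps, whereas the
  distance to a fixed point may grow in a longer step. The increments of the iterates vanish because
  the step lengths are bounded by \<open>amax\<close>.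
\<close>

text \<open>
  The residual at the relaxed point \<open>y = u + a *\<^sub>R residual S u\<close> is
  \<open>(S y - S u) + (1 - a) *\<^sub>R residual S u\<close>, where the first summand is at most
  \<open>norm (y - u) = a * norm (residual S u)\<close> in norm.
\<close>
lemma norm_residual_relaxed_step_le:
  assumes S: "nonexpansive S" and a: "0 \<le> a" "a \<le> 1"
  shows "norm (residual S (u + a *\<^sub>R residual S u)) \<le> norm (residual S u)"
proof -
  let ?r = "residual S u"
  let ?y = "u + a *\<^sub>R ?r"
  have "residual S ?y = (S ?y - S u) + (1 - a) *\<^sub>R ?r"
    by (simp add: residual_def algebra_simps)
  then have "norm (residual S ?y) \<le> norm (S ?y - S u) + norm ((1 - a) *\<^sub>R ?r)"
    by (simp only: norm_triangle_ineq)
  also have "norm (S ?y - S u) \<le> norm (?y - u)"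
    using S by (simp only: nonexpansive_def)
  also have "norm (?y - u) + norm ((1 - a) *\<^sub>R ?r) = a * norm ?r + (1 - a) * norm ?r"
    using a by simp
  also have "\<dots> = norm ?r"
    by (simp add: algebra_simps)
  finally show ?thesis
    by simp
qed

text \<open>
  The subtracted term is the defect in the convexity of the squared norm. It is the source of the
  decrease in the Krasnoselskii-Mann iteration.
\<close>
lemma norm_convex_combination_squared:
  fixes u v :: "'a::real_inner"
  shows "(norm (u + a *\<^sub>R (v - u)))\<^sup>2
    = (1 - a) * (norm u)\<^sup>2 + a * (norm v)\<^sup>2 - a * (1 - a) * (norm (v - u))\<^sup>2"
  by (simp add: power2_norm_eq_inner inner_commute algebra_simps)

text \<open>
  Seen from a fixed point \<open>p\<close>, the new point \<open>u + a *\<^sub>R residual S u\<close> is the convex combination of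
  \<open>u - p\<close> and \<open>S u - S p\<close>, and the latter is no longer than the former.
\<close>
lemma relaxed_step_fixed_point_descent:
  assumes S: "nonexpansive S" and p: "p \<in> fixed_points S" and a: "0 \<le> a"
  shows "(norm (u + a *\<^sub>R residual S u - p))\<^sup>2
    \<le> (norm (u - p))\<^sup>2 - a * (1 - a) * (norm (residual S u))\<^sup>2"
proof -
  have Sp: "S p = p"
    using p by (simp add: fixed_points_def)
  have "norm (S u - p) \<le> norm (u - p)"
    using S Sp unfolding nonexpansive_def by metis
  then have "a * (norm (S u - p))\<^sup>2 \<le> a * (norm (u - p))\<^sup>2"
    using a by (intro mult_left_mono power_mono) auto
  moreover have "(norm (u + a *\<^sub>R residual S u - p))\<^sup>2
    = (1 - a) * (norm (u - p))\<^sup>2 + a * (norm (S u - p))\<^sup>2 - a * (1 - a) * (norm (residual S u))\<^sup>2"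
    using norm_convex_combination_squared[of "u - p" a "S u - p"]
    by (simp add: residual_def algebra_simps)
  ultimately show ?thesis
    by (simp add: algebra_simps)
qed

lemma no_perpetual_decrease:
  fixes e :: "nat \<Rightarrow> real"
  assumes nonneg: "\<And>k. 0 \<le> e k" and c: "0 < c"
    and dec: "\<And>k. K \<le> k \<Longrightarrow> e (Suc k) \<le> e k - c"
  shows False
proof -
  have le: "e (K + n) \<le> e K - real n * c" for n
  proof (induction n)
    case (Suc n)
    then show ?case using dec[of "K + n"] by (simp add: algebra_simps)
  qed simp
  obtain n where "e K < real n * c"
    using reals_Archimedean3[OF c] by blast
  then show False
    using le[of n] nonneg[of "K + n"] by linarith
qed

theorem theorem2:
  fixes S :: "real ^ 'n \<Rightarrow> real ^ 'n"
    and x :: "nat \<Rightarrow> real ^ 'n"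
    and \<alpha> :: "nat \<Rightarrow> real"
    and abar \<epsilon> amax :: real
  assumes "nonexpansive S"
    and "fixed_points S \<noteq> {}"
    and "0 < abar" and "abar < 1"
    and "0 < \<epsilon>" and "\<epsilon> < 1"
    and "abar \<le> amax"
    and "line_search_iteration S abar \<epsilon> amax x \<alpha>"
  shows "(\<lambda>k. residual S (x k)) \<longlonglongrightarrow> 0 \<and> (\<lambda>k. x (Suc k) - x k) \<longlonglongrightarrow> 0"
proof -
  define d where "d k = norm (residual S (x k))" for k
  have step: "x (Suc k) = x k + \<alpha> k *\<^sub>R residual S (x k)" for k
    using assms(8) by (simp add: line_search_iteration_def)
  have choice: "\<alpha> k = abar \<or> (\<alpha> k \<in> {abar<..amax} \<and>
      d (Suc k) \<le> (1 - \<epsilon>) * norm (residual S (x k + abar *\<^sub>R residual S (x k))))" for k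
    using assms(8) unfolding line_search_iteration_def d_def by blast
  have nominal_le: "norm (residual S (x k + abar *\<^sub>R residual S (x k))) \<le> d k" for k
    using norm_residual_relaxed_step_le[of S abar "x k"] assms(1,3,4) by (simp add: d_def)
  have contract: "d (Suc k) \<le> (1 - \<epsilon>) * d k" if "\<alpha> k \<noteq> abar" for k
    using choice[of k] that mult_left_mono[OF nominal_le[of k], of "1 - \<epsilon>"] assms(6) by linarith
  have d_nonneg: "0 \<le> d k" for k
    by (simp add: d_def)
  have d_Suc_le: "d (Suc k) \<le> d k" for k
  proof (cases "\<alpha> k = abar")
    case True
    then show ?thesis using nominal_le[of k] step[of k] by (simp add: d_def)
  next
    case False
    have "(1 - \<epsilon>) * d k \<le> d k"
      using d_nonneg[of k] assms(5) by (simp add: algebra_simps)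
    with contract[OF False] show ?thesis by linarith
  qed
  obtain L where L: "d \<longlonglongrightarrow> L" and L_le: "\<And>k. L \<le> d k"
    using decseq_convergent[of d 0] d_Suc_le d_nonneg decseq_SucI by metis
  have "L \<le> 0"
  proof (rule ccontr)
    assume "\<not> L \<le> 0"
    then have Lpos: "0 < L" by simp
    have "L < L / (1 - \<epsilon>)"
      using Lpos assms(5,6) by (simp add: field_simps)
    then obtain K where K: "\<And>k. K \<le> k \<Longrightarrow> d k < L / (1 - \<epsilon>)"
      using order_tendstoD(2)[OF L] unfolding eventually_sequentially by blast
    have nominal: "\<alpha> k = abar" if "K \<le> k" for k
    proof (rule ccontr)
      assume "\<alpha> k \<noteq> abar"
      then have "d (Suc k) \<le> (1 - \<epsilon>) * d k"
        by (rule contract)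
      also have "\<dots> < L"
        using K[OF that] assms(6) by (simp add: field_simps)
      finally show False using L_le[of "Suc k"] by linarith
    qed
    obtain p where p: "p \<in> fixed_points S"
      using assms(2) by blast
    have descent: "(norm (x (Suc k) - p))\<^sup>2 \<le> (norm (x k - p))\<^sup>2 - abar * (1 - abar) * L\<^sup>2"
      if "K \<le> k" for k
    proof -
      have "abar * (1 - abar) * L\<^sup>2 \<le> abar * (1 - abar) * (d k)\<^sup>2"
        using assms(3,4) Lpos L_le[of k] by (intro mult_left_mono power_mono) auto
      moreover have "(norm (x (Suc k) - p))\<^sup>2
          \<le> (norm (x k - p))\<^sup>2 - abar * (1 - abar) * (d k)\<^sup>2"
        using relaxed_step_fixed_point_descent[OF assms(1) p, of abar "x k"] assms(3)
          step[of k] nominal[OF that] by (simp add: d_def)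
      ultimately show ?thesis by linarith
    qed
    show False
      using no_perpetual_decrease[of "\<lambda>k. (norm (x k - p))\<^sup>2" "abar * (1 - abar) * L\<^sup>2" K]
        descent assms(3,4) Lpos by simp
  qed
  moreover have "0 \<le> L"
    using LIMSEQ_le_const[OF L] d_nonneg by blast
  ultimately have d_lim: "d \<longlonglongrightarrow> 0"
    using L by simp
  have increment: "norm (x (Suc k) - x k) \<le> amax * d k" for k
  proof -
    have "\<bar>\<alpha> k\<bar> \<le> amax"
      using choice[of k] assms(3,7) by auto
    then show ?thesis
      using step[of k] d_nonneg[of k] by (simp add: d_def mult_right_mono)
  qed
  have "(\<lambda>k. x (Suc k) - x k) \<longlonglongrightarrow> 0"
  proof (rule Lim_null_comparison)
    show "\<forall>\<^sub>F k in sequentially. norm (x (Suc k) - x k) \<le> amax * d k"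
      using increment by simp
    show "(\<lambda>k. amax * d k) \<longlonglongrightarrow> 0"
      using tendsto_mult_right_zero[OF d_lim] by simp
  qed
  moreover have "(\<lambda>k. residual S (x k)) \<longlonglongrightarrow> 0"
    using d_lim unfolding d_def by (rule tendsto_norm_zero_cancel)
  ultimately show ?thesis by blast
qed

end
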